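(* Let $p$ be a prime and let $k$ be a natural number. Then $T(p^k)\equiv k+1 \pmod p$.
   Context: For a natural number $n$, $T(n)$ denotes the number of distinct topologies which can be defined on a set with $n$ elements (topologies are counted as distinct families of subsets, not up to homeomorphism). *)

theory Defs
  imports "HOL-Analysis.Analysis" "HOL-Number_Theory.Number_Theory"
begin

text \<open>
  The canonical set with \<open>n\<close> elements is \<open>{..<n}\<close>.  Values of type \<open>'a topology\<close> are equal iff they
  have the same open sets, so topologies are counted as families of subsets, not up to
  homeomorphism.
\<close>

definition num_topologies :: "nat \<Rightarrow> nat" where
  "num_topologies n = card {X :: nat topology. topspace X = {..<n}}"

text \<open>The set being counted is finite, so \<open>card\<close> does not take its default value \<open>0\<close>.\<close>

lemma finite_topologies_on:
  assumes "finite S"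
  shows "finite {X :: 'a topology. topspace X = S}"
proof -
  have "inj_on (\<lambda>X. Collect (openin X)) {X :: 'a topology. topspace X = S}"
    by (auto simp: inj_on_def topology_eq set_eq_iff)
  moreover have "(\<lambda>X. Collect (openin X)) ` {X :: 'a topology. topspace X = S} \<subseteq> Pow (Pow S)"
    using openin_subset by fastforce
  ultimately show ?thesis
    using assms by (meson finite_Pow_iff finite_imageD finite_subset)
qed

text \<open>The choice of the underlying set (and of its element type) is immaterial.\<close>

lemma card_topologies_le:
  fixes S :: "'a set" and R :: "'b set"
  assumes "finite R" and f: "bij_betw f S R"
  shows "card {X :: 'a topology. topspace X = S} \<le> card {X :: 'b topology. topspace X = R}"
proof (rule card_inj_on_le)
  define g where "g = the_inv_into S f"
  let ?P = "\<lambda>X. pullback_topology R g X"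
  have gS: "g y \<in> S" and fg: "f (g y) = y" if "y \<in> R" for y
    using that f by (auto simp: g_def bij_betw_def the_inv_into_into f_the_inv_into_f)
  have fR: "f x \<in> R" and gf: "g (f x) = x" if "x \<in> S" for x
    using that f by (auto simp: g_def bij_betw_def the_inv_into_f_f)
  have vim: "f -` (g -` U \<inter> R) \<inter> S = U" if "U \<subseteq> S" for U
    using that fR gf by auto
  show "inj_on ?P {X. topspace X = S}"
  proof (rule inj_onI)
    fix X Y :: "'a topology"
    assume XY: "X \<in> {X. topspace X = S}" "Y \<in> {X. topspace X = S}" and eq: "?P X = ?P Y"
    have *: "openin B U"
      if "openin A U" "topspace A = S" "topspace B = S" "?P A = ?P B" for A B :: "'a topology" and U
    proof -
      have "openin (?P B) (g -` U \<inter> R)"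
        using that by (metis openin_pullback_topology)
      then obtain V where V: "openin B V" "g -` U \<inter> R = g -` V \<inter> R"
        by (auto simp: openin_pullback_topology)
      have "U \<subseteq> S" "V \<subseteq> S"
        using that V openin_subset by blast+
      then have "U = V" using V(2) vim by metis
      then show ?thesis using V by simp
    qed
    show "X = Y"
      unfolding topology_eq using *[of X _ Y] *[of Y _ X] XY eq by auto
  qed
  show "?P ` {X. topspace X = S} \<subseteq> {X. topspace X = R}"
    using gS by (auto simp: topspace_pullback_topology)
  show "finite {X :: 'b topology. topspace X = R}"
    using assms by (rule_tac finite_topologies_on)
qed

lemma num_topologies_eq:
  fixes S :: "'a set"
  assumes "finite S"
  shows "card {X :: 'a topology. topspace X = S} = num_topologies (card S)"
proof -
  obtain f where "bij_betw f S {..<card S}"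
    using assms by (metis atLeast0LessThan ex_bij_betw_finite_nat)
  then show ?thesis
    unfolding num_topologies_def
    using card_topologies_le assms bij_betw_inv_into by (metis finite_lessThan le_antisym)
qed

end

theory Submission
  imports Defs "HOL-Combinatorics.Orbits"
begin

text \<open>
  Identify the \<open>n\<close>-point set \<open>{..<n}\<close> with \<open>\<int>/n\<close>, so that the cyclic group \<open>\<int>/n\<close> acts on the set of
  topologies by translation.  If \<open>n = p ^ k\<close>, every orbit has \<open>p\<close>-power size, hence modulo \<open>p\<close> only
  the translation-invariant topologies matter (\<open>card_fixed_points_cong\<close>).

  A topology on a finite set is determined by its specialization preorder.  If the topology is
  invariant under translation, then so is the preorder, which is therefore determined by the least
  open set containing \<open>0\<close>.  By transitivity this is a submonoid of the finite group \<open>\<int>/n\<close>, and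
  hence a subgroup.  So the invariant topologies correspond to the subgroups of \<open>\<int>/n\<close>, that
  is, to the divisors \<open>d\<close> of \<open>n\<close>: the open sets for \<open>d\<close> are the unions of residue classes modulo \<open>d\<close>
  (\<open>invariant_topology_is_periodic\<close>, \<open>bij_betw_divisors_invariant\<close>).  The number \<open>p ^ k\<close> has
  \<open>k + 1\<close> divisors.
\<close>

section \<open>Fixed points of maps of prime power order\<close>

text \<open>
  The size of an orbit is the least positive period, which divides every period; division with
  remainder reduces a period modulo the least one.
\<close>

lemma card_orbit_dvd_period:
  assumes "(f ^^ m) x = x" "0 < m"
  shows "card (orbit f x) dvd m"
proof -
  define d where "d = funpow_dist1 f x x"
  have self: "x \<in> orbit f x"
    unfolding orbit_altdef using assms by (intro CollectI exI[of _ m]) auto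
  have "card (orbit f x) = d"
    using orbit_conv_funpow_dist1[OF self] card_image[OF inj_on_funpow_dist1[OF self]]
    unfolding d_def by simp
  moreover have "(f ^^ d) x = x"
    unfolding d_def by (rule funpow_dist1_prop[OF self])
  then have "(f ^^ (m mod d)) x = x"
    using funpow_mod_eq[of d f x m] assms(1) by simp
  then have "\<not> (0 < m mod d \<and> m mod d < d)"
    using funpow_dist1_least[of "m mod d" f x x] unfolding d_def[symmetric] by blast
  then have "m mod d = 0"
    unfolding d_def by simp
  ultimately show ?thesis
    by (simp add: dvd_eq_mod_eq_0)
qed

text \<open>
  The orbits partition \<open>A\<close>.  Each has size dividing \<open>p ^ k\<close>, so an orbit that is not a single fixed
  point has size divisible by \<open>p\<close>.
\<close>

lemma card_fixed_points_cong:
  fixes p k :: nat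
  assumes p: "prime p" and A: "finite A" "f ` A \<subseteq> A"
    and period: "\<And>x. x \<in> A \<Longrightarrow> (f ^^ (p ^ k)) x = x"
  shows "[card A = card {x \<in> A. f x = x}] (mod p)"
proof -
  let ?F = "{x \<in> A. f x = x}"
  have pos: "0 < p ^ k"
    using p by (simp add: prime_gt_0_nat)
  have self: "x \<in> orbit f x" if "x \<in> A" for x
    unfolding orbit_altdef using pos period[OF that] by (intro CollectI exI[of _ "p ^ k"]) auto
  have orbit_sub: "orbit f x \<subseteq> A" if "x \<in> A" for x
  proof
    fix y assume "y \<in> orbit f x"
    then show "y \<in> A"
      by induction (use A that in auto)
  qed
  have orbit_eq: "orbit f y = orbit f x" if "x \<in> A" "y \<in> orbit f x" for x y
    using orbit_trans[OF _ that(2)] orbit_trans[OF _ orbit_swap[OF self[OF that(1)] that(2)]]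
    by auto
  have moved: "orbit f x \<inter> ?F = {}" if "x \<in> A - ?F" for x
  proof -
    have False if "y \<in> orbit f x" "f y = y" for y
    proof -
      have "orbit f x = {y}"
        using orbit_eq[of x y] \<open>x \<in> A - ?F\<close> that orbit_eq_singleton_iff[of f y] by simp
      then show False
        using self[of x] \<open>x \<in> A - ?F\<close> that(2) by auto
    qed
    then show ?thesis
      by blast
  qed
  have "p dvd card (\<Union>(orbit f ` (A - ?F)))"
  proof (rule dvd_partition)
    show "finite (\<Union>(orbit f ` (A - ?F)))"
      by (rule finite_subset[OF _ A(1)]) (use orbit_sub in blast)
    show "\<forall>c\<in>orbit f ` (A - ?F). p dvd card c"
    proof
      fix c assume "c \<in> orbit f ` (A - ?F)"
      then obtain x where x: "x \<in> A" "f x \<noteq> x" and c: "c = orbit f x"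
        by auto
      obtain i where i: "card c = p ^ i"
        using card_orbit_dvd_period[OF period[OF x(1)] pos] divides_primepow_nat[OF p] c by auto
      have "card c \<noteq> 1"
      proof
        assume "card c = 1"
        then obtain y where "orbit f x = {y}"
          unfolding c by (rule card_1_singletonE)
        then show False
          using x(2) self[OF x(1)] orbit_eq_singleton_iff[of f x] by auto
      qed
      then show "p dvd card c"
        using i by (cases i) auto
    qed
    show "\<forall>c1\<in>orbit f ` (A - ?F). \<forall>c2\<in>orbit f ` (A - ?F). c1 \<noteq> c2 \<longrightarrow> c1 \<inter> c2 = {}"
    proof (intro ballI impI)
      fix c1 c2 assume "c1 \<in> orbit f ` (A - ?F)" "c2 \<in> orbit f ` (A - ?F)" "c1 \<noteq> c2"
      then obtain x1 x2 where "x1 \<in> A" "x2 \<in> A" "c1 = orbit f x1" "c2 = orbit f x2"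
        by auto
      then show "c1 \<inter> c2 = {}"
        using orbit_eq \<open>c1 \<noteq> c2\<close> by (metis disjoint_iff)
    qed
  qed
  moreover have "\<Union>(orbit f ` (A - ?F)) = A - ?F"
  proof
    show "\<Union>(orbit f ` (A - ?F)) \<subseteq> A - ?F"
      using orbit_sub moved by blast
    show "A - ?F \<subseteq> \<Union>(orbit f ` (A - ?F))"
      using self by blast
  qed
  moreover have "card A = card (A - ?F) + card ?F"
    using card_Diff_subset[of ?F A] card_mono[of A ?F] A(1) by fastforce
  ultimately show ?thesis
    by (auto simp: cong_def elim!: dvdE)
qed

section \<open>Translating topologies on the integers modulo \<open>n\<close>\<close>

definition translate :: "nat \<Rightarrow> nat \<Rightarrow> nat topology \<Rightarrow> nat topology" where
  "translate n i X = pullback_topology {..<n} (\<lambda>x. (x + i) mod n) X"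

lemma openin_translate:
  "openin (translate n i X) W \<longleftrightarrow> (\<exists>U. openin X U \<and> W = {x. x < n \<and> (x + i) mod n \<in> U})"
  unfolding translate_def openin_pullback_topology by (intro ex_cong1) auto

lemma topspace_translate:
  assumes "topspace X = {..<n}"
  shows "topspace (translate n i X) = {..<n}"
  using assms by (auto simp: translate_def topspace_pullback_topology)

lemma translate_period:
  assumes "topspace X = {..<n}" "n dvd i"
  shows "translate n i X = X"
proof -
  have "{x. x < n \<and> (x + i) mod n \<in> U} = U" if "openin X U" for U
  proof -
    have "(x + i) mod n = x" if "x < n" for x
      using assms(2) that by (auto simp: dvd_def)
    then show ?thesis
      using openin_subset[OF that] assms(1) by auto
  qed
  then have "openin (translate n i X) W \<longleftrightarrow> openin X W" for W
    unfolding openin_translate by auto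
  then show ?thesis
    by (simp add: topology_eq)
qed

lemma translate_translate: "translate n i (translate n j X) = translate n (i + j) X"
proof -
  have "((x + i) mod n < n \<and> ((x + i) mod n + j) mod n \<in> U) = ((x + (i + j)) mod n \<in> U)"
    if "x < n" for x U
    using that by (simp add: mod_add_left_eq add.assoc)
  then have "{x. x < n \<and> (x + i) mod n \<in> {y. y < n \<and> (y + j) mod n \<in> U}}
      = {x. x < n \<and> (x + (i + j)) mod n \<in> U}" for U
    by blast
  then have "openin (translate n i (translate n j X)) W \<longleftrightarrow> openin (translate n (i + j) X) W" for W
    unfolding openin_translate by auto
  then show ?thesis
    by (simp add: topology_eq)
qed

lemma funpow_translate:
  assumes "topspace X = {..<n}"
  shows "(translate n 1 ^^ i) X = translate n i X"
proof (induction i)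
  case 0
  then show ?case
    using translate_period[OF assms, of 0] by simp
next
  case (Suc i)
  then show ?case
    by (simp add: translate_translate)
qed

section \<open>Translation-invariant topologies\<close>

text \<open>For \<open>d\<close> dividing \<open>n\<close>, the open sets are the unions of cosets of the subgroup generated by \<open>d\<close>.\<close>

definition periodic_topology :: "nat \<Rightarrow> nat \<Rightarrow> nat topology" where
  "periodic_topology n d = topology (\<lambda>U. U \<subseteq> {..<n} \<and> (\<forall>x\<in>U. (x + d) mod n \<in> U))"

lemma openin_periodic_topology:
  "openin (periodic_topology n d) U \<longleftrightarrow> U \<subseteq> {..<n} \<and> (\<forall>x\<in>U. (x + d) mod n \<in> U)"
proof -
  have "istopology (\<lambda>U. U \<subseteq> {..<n} \<and> (\<forall>x\<in>U. (x + d) mod n \<in> U))"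
    unfolding istopology_def by blast
  then show ?thesis
    unfolding periodic_topology_def by (simp add: topology_inverse')
qed

lemma topspace_periodic_topology: "topspace (periodic_topology n d) = {..<n}"
proof -
  have "openin (periodic_topology n d) {..<n}"
    unfolding openin_periodic_topology by auto
  then show ?thesis
    using openin_subset openin_topspace openin_periodic_topology by (metis subset_antisym)
qed

lemma translate_periodic_topology:
  assumes "0 < n"
  shows "translate n i (periodic_topology n d) = periodic_topology n d" (is "translate n i ?P = ?P")
proof -
  have le: "openin ?P W" if W_open: "openin (translate n j ?P) W" for W j
  proof -
    obtain U where U: "openin ?P U" and W: "W = {x. x < n \<and> (x + j) mod n \<in> U}"
      using W_open unfolding openin_translate by blast
    have "((x + d) mod n + j) mod n \<in> U" if "(x + j) mod n \<in> U" for x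
    proof -
      have "((x + j) mod n + d) mod n \<in> U"
        using U that unfolding openin_periodic_topology by simp
      then show ?thesis
        unfolding mod_add_left_eq by (simp only: ac_simps)
    qed
    then show ?thesis
      using assms unfolding openin_periodic_topology W by auto
  qed
  \<comment> \<open>The translation by \<open>n * i - i\<close> is inverse to the one by \<open>i\<close>, so the inclusion just proved
    for it gives the reverse inclusion for \<open>i\<close>.\<close>
  have "i + (n * i - i) = n * i"
    using assms by (cases n) auto
  then have inverse: "translate n i (translate n (n * i - i) ?P) = ?P"
    by (simp add: translate_translate translate_period topspace_periodic_topology)
  have "openin (translate n i ?P) W" if "openin ?P W" for W
  proof -
    have W_open: "openin (translate n i (translate n (n * i - i) ?P)) W"
      using that inverse by simp
    obtain V where "openin (translate n (n * i - i) ?P) V"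
      and W: "W = {x. x < n \<and> (x + i) mod n \<in> V}"
      using W_open unfolding openin_translate[of n i] by blast
    then have "openin ?P V"
      using le by simp
    then show ?thesis
      unfolding openin_translate W by (intro exI[of _ V] conjI refl)
  qed
  then show ?thesis
    unfolding topology_eq using le by (intro allI iffI)
qed

text \<open>
  The set \<open>D\<close> below consists of the representatives of the least open set containing \<open>0\<close>: by
  invariance, if every open set containing \<open>x\<close> also contains \<open>x + m\<close> modulo \<open>n\<close> for one \<open>x\<close>,
  then this holds for all \<open>x\<close>, which is the definition of \<open>m \<in> D\<close>.  The set \<open>D\<close> is closed
  under addition and contains \<open>n\<close>.  Negatives modulo \<open>n\<close> are positive multiples, so remainders of
  elements of \<open>D\<close> modulo each other stay in \<open>D\<close>, and \<open>D\<close> consists of the multiples of its least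
  positive element.
\<close>

lemma invariant_topology_is_periodic:
  assumes n: "0 < n" and X: "topspace X = {..<n}" and fixed: "translate n 1 X = X"
  obtains d where "d dvd n" "X = periodic_topology n d"
proof -
  have inv: "translate n i X = X" for i
    unfolding funpow_translate[OF X, symmetric] by (induction i) (use fixed in auto)
  have shift: "openin X {x. x < n \<and> (x + i) mod n \<in> U}" if "openin X U" for U i
    using that inv[of i] openin_translate[of n i X] by metis
  have less: "x < n" if "openin X U" "x \<in> U" for x U
    using openin_subset[OF that(1)] that(2) X by auto
  define D where "D = {m. \<forall>U. openin X U \<longrightarrow> (\<forall>x\<in>U. (x + m) mod n \<in> U)}"
  have cong: "m' \<in> D" if "m \<in> D" "m mod n = m' mod n" for m m'
  proof -
    have "(x + m') mod n = (x + m) mod n" for x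
      using that(2) by (metis mod_add_right_eq)
    then show ?thesis
      using that(1) by (simp add: D_def)
  qed
  have zero: "0 \<in> D"
    using less by (auto simp: D_def)
  have add: "a + b \<in> D" if "a \<in> D" "b \<in> D" for a b
  proof -
    have "(x + (a + b)) mod n \<in> U" if "openin X U" "x \<in> U" for x U
    proof -
      have "((x + a) mod n + b) mod n \<in> U"
        using that \<open>a \<in> D\<close> \<open>b \<in> D\<close> by (auto simp: D_def)
      then show ?thesis
        by (simp add: mod_add_left_eq add.assoc)
    qed
    then show ?thesis
      by (simp add: D_def)
  qed
  have mult: "c * a \<in> D" if "a \<in> D" for a c
    by (induction c) (use that zero add in auto)
  have "n \<in> D"
    using cong[OF zero] by simp
  define d where "d = (LEAST d. 0 < d \<and> d \<in> D)"
  have d: "0 < d" "d \<in> D"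
    using LeastI[of "\<lambda>d. 0 < d \<and> d \<in> D" n] n \<open>n \<in> D\<close> unfolding d_def by auto
  have dvd: "d dvd m" if "m \<in> D" for m
  proof -
    \<comment> \<open>Adding \<open>n - 1\<close> copies of a number amounts to subtracting it modulo \<open>n\<close>.\<close>
    let ?q = "m div d * d"
    have "m + (n - 1) * ?q = m mod d + (?q + (n - 1) * ?q)"
      using mod_div_mult_eq[of m d] by linarith
    also have "?q + (n - 1) * ?q = n * ?q"
      using n by (cases n) auto
    finally have "(m + (n - 1) * ?q) mod n = (m mod d) mod n"
      by simp
    moreover have "m + (n - 1) * ?q \<in> D"
      using that d(2) add mult by blast
    ultimately have "m mod d \<in> D"
      using cong by blast
    then have "\<not> 0 < m mod d"
      using not_less_Least[of "m mod d" "\<lambda>d. 0 < d \<and> d \<in> D"] d(1) unfolding d_def[symmetric] by auto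
    then show ?thesis
      by auto
  qed
  have "openin X U" if U: "openin (periodic_topology n d) U" for U
  proof -
    \<comment> \<open>As there are finitely many open sets, \<open>x\<close> has a least open neighbourhood.
      By invariance it consists of the \<open>x + m\<close> with \<open>m \<in> D\<close>, so \<open>U\<close> is a union of such sets.\<close>
    define N where "N x = \<Inter>{V. openin X V \<and> x \<in> V}" for x
    have "{V. openin X V} \<subseteq> Pow {..<n}"
      using openin_subset X by blast
    then have fin: "finite {V. openin X V}"
      by (rule finite_subset) auto
    have "openin X (N x)" "x \<in> N x" "N x \<subseteq> U" if x: "x \<in> U" for x
    proof -
      have xn: "x < n" and U_add: "\<And>y. y \<in> U \<Longrightarrow> (y + d) mod n \<in> U"
        using U x by (auto simp: openin_periodic_topology)
      then have top: "openin X {..<n} \<and> x \<in> {..<n}"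
        using X openin_topspace[of X] by simp
      show "openin X (N x)"
        unfolding N_def
      proof (rule openin_Inter)
        show "finite {V. openin X V \<and> x \<in> V}"
          by (rule finite_subset[OF _ fin]) auto
      qed (use top in auto)
      show "x \<in> N x"
        by (simp add: N_def)
      show "N x \<subseteq> U"
      proof
        fix y assume y: "y \<in> N x"
        then have yn: "y < n"
          using top by (auto simp: N_def)
        define m where "m = y + (n - x)"
        have xm: "x + m = y + n"
          using xn by (simp add: m_def)
        have "m \<in> D"
          unfolding D_def
        proof (intro CollectI allI impI ballI)
          fix V z assume V: "openin X V" and z: "z \<in> V"
          \<comment> \<open>Move \<open>z\<close> to \<open>x\<close>, use the neighbourhood of \<open>x\<close> so obtained, and move back.\<close>
          let ?i = "z + (n - x)"
          have "x + ?i = z + n"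
            using xn by simp
          then have "(x + ?i) mod n = z"
            using less[OF V z] by (metis mod_add_self2 mod_less)
          then have "x \<in> {w. w < n \<and> (w + ?i) mod n \<in> V}"
            using xn z by simp
          then have "(y + ?i) mod n \<in> V"
            using y shift[OF V, of ?i] by (auto simp: N_def)
          moreover have "y + ?i = z + m"
            by (simp add: m_def)
          ultimately show "(z + m) mod n \<in> V"
            by metis
        qed
        then obtain c where c: "m = d * c"
          using dvd by (auto simp: dvd_def)
        have "(x + d * j) mod n \<in> U" for j
        proof (induction j)
          case 0
          then show ?case
            using x xn by simp
        next
          case (Suc j)
          then have "((x + d * j) mod n + d) mod n \<in> U"
            by (rule U_add)
          then show ?case
            unfolding mod_add_left_eq by (simp add: ac_simps)
        qed
        from this[of c] show "y \<in> U"
          using xm yn c by simp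
      qed
    qed
    then have "U = (\<Union>x\<in>U. N x)" "openin X (\<Union>x\<in>U. N x)"
      by (blast, blast intro: openin_Union)
    then show ?thesis
      by simp
  qed
  moreover have "openin (periodic_topology n d) U" if "openin X U" for U
    using that d(2) less[OF that] by (auto simp: openin_periodic_topology D_def)
  ultimately have "X = periodic_topology n d"
    unfolding topology_eq by blast
  then show thesis
    using that dvd[OF \<open>n \<in> D\<close>] by blast
qed

text \<open>The multiples of \<open>d\<close> form an open set containing \<open>0\<close>, from which \<open>d\<close> can be recovered.\<close>

lemma periodic_topology_eq_dvd:
  assumes "0 < n" "d dvd n" and eq: "periodic_topology n d = periodic_topology n e"
  shows "d dvd e"
proof -
  let ?M = "{x. x < n \<and> d dvd x}"
  have "openin (periodic_topology n d) ?M"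
    using assms(1,2) by (auto simp: openin_periodic_topology dvd_mod_iff)
  then have "(0 + e) mod n \<in> ?M"
    using assms(1) unfolding eq openin_periodic_topology by blast
  then show ?thesis
    using assms(2) by (simp add: dvd_mod_iff)
qed

lemma bij_betw_divisors_invariant:
  assumes n: "0 < n"
  shows "bij_betw (periodic_topology n) {d. d dvd n} {X. topspace X = {..<n} \<and> translate n 1 X = X}"
  unfolding bij_betw_def
proof
  show "inj_on (periodic_topology n) {d. d dvd n}"
    using periodic_topology_eq_dvd[OF n] by (auto intro!: inj_onI dvd_antisym)
  show "periodic_topology n ` {d. d dvd n} = {X. topspace X = {..<n} \<and> translate n 1 X = X}"
  proof
    show "periodic_topology n ` {d. d dvd n} \<subseteq> {X. topspace X = {..<n} \<and> translate n 1 X = X}"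
      by (auto simp: topspace_periodic_topology translate_periodic_topology[OF n])
    show "{X. topspace X = {..<n} \<and> translate n 1 X = X} \<subseteq> periodic_topology n ` {d. d dvd n}"
    proof clarify
      fix X assume "topspace X = {..<n}" "translate n 1 X = X"
      then obtain d where "d dvd n" "X = periodic_topology n d"
        using n by (rule_tac invariant_topology_is_periodic)
      then show "X \<in> periodic_topology n ` {d. d dvd n}"
        by simp
    qed
  qed
qed

theorem theorem2p4:
  fixes p k :: nat
  assumes "prime p"
  shows "[num_topologies (p ^ k) = k + 1] (mod p)"
proof -
  let ?n = "p ^ k"
  let ?A = "{X :: nat topology. topspace X = {..<?n}}"
  have n: "0 < ?n"
    using assms by (simp add: prime_gt_0_nat)
  have "[card ?A = card {X \<in> ?A. translate ?n 1 X = X}] (mod p)"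
  proof (rule card_fixed_points_cong[OF assms])
    show "finite ?A"
      by (simp add: finite_topologies_on)
    show "translate ?n 1 ` ?A \<subseteq> ?A"
      using topspace_translate by auto
    show "(translate ?n 1 ^^ ?n) X = X" if "X \<in> ?A" for X
      using that funpow_translate[of X ?n ?n] translate_period[of X ?n ?n] by simp
  qed
  also have "card {X \<in> ?A. translate ?n 1 X = X} = card {d. d dvd ?n}"
    using bij_betw_same_card[OF bij_betw_divisors_invariant[OF n]] by simp
  also have "{d. d dvd ?n} = (\<lambda>i. p ^ i) ` {..k}"
    using divides_primepow_nat[OF assms] by auto
  also have "card \<dots> = k + 1"
    using prime_gt_1_nat[OF assms] by (subst card_image) (auto simp: inj_on_def power_inject_exp)
  finally show ?thesis
    by (simp add: num_topologies_def)
qed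

end
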